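(* Suppose a deck of $n$ cards is given a shelf shuffle with a single shelf, and the player receives no feedback. The player should follow the following (incomplete) optimal guessing strategy. Card $1$ should be guessed in positions $1$ and $n$, and cards $2$ or $3$ should be guessed in positions $2$ and $n-1$. If $n$ is even, card $n-1$ or card $n$ should be guessed in positions $\frac{n}{2}$ and $\frac{n}{2}+1$. If $n$ is odd, card $n-1$ or card $n$ should be guessed in position $\frac{n+1}{2}$.
   Context: Single-shelf shuffle: a deck of cards is initially labeled $1,2,\dots,n$ from top to bottom. Cards are drawn one at a time from the bottom of the deck (card $n$ first, card $1$ last) and placed in a pile; each drawn card is placed, independently, at the top or at the bottom of the existing pile with probability $1/2$ each. The final pile is the shuffled deck, with position $1$ at its top. The shuffle is performed once. Let $p_{i,j}$ be the probability that card $i$ lands in position $j$. A no-feedback guessing strategy is a choice of a card $g_j\in\{1,\dots,n\}$ to guess in each position $j\in\{1,\dots,n\}$, where the player receives no information after each guess; its expected number of correct guesses is $\sum_{j=1}^n p_{g_j,j}$. A strategy is optimal if it maximizes this expected number, that is, if for every $j$ the card $g_j$ attains $\max_{1\le i\le n}p_{i,j}$; a card should be guessed in position $j$ if it attains this maximum. The strategy is called incomplete because it specifies guesses only for some of the positions.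
   Formalization: That card 2 and card 3 are each optimal in positions 2 and n−1 is proved for all n except 4, where card 2 fails (probability 1/4 against 3/8 for card 3); for n = 4 only that card 2 or card 3 is optimal is claimed there. Cards and positions that do not exist for n = 1, 2 are dropped. *)

theory Defs
  imports "HOL-Probability.Probability_Mass_Function"
begin

text \<open>
  A pile is a list of cards with its top card first. The first argument of \<open>shelf_place\<close> lists the
  cards still to be placed, in the order in which they are drawn.
\<close>

primrec shelf_place :: "nat list \<Rightarrow> nat list \<Rightarrow> nat list pmf" where
  "shelf_place [] pile = return_pmf pile"
| "shelf_place (c # cs) pile =
     bind_pmf (bernoulli_pmf (1/2))
       (\<lambda>top. shelf_place cs (if top then c # pile else pile @ [c]))"

definition shelf_shuffle :: "nat \<Rightarrow> nat list pmf" where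
  "shelf_shuffle n = shelf_place (rev [1..<Suc n]) []"

text \<open>
  Positions are numbered from 1, list indices from 0. The three functions below are meaningful only
  for positions in \<open>{1..n}\<close>.
\<close>

definition card_prob :: "nat \<Rightarrow> nat \<Rightarrow> nat \<Rightarrow> real" where
  "card_prob n i j = measure_pmf.prob (shelf_shuffle n) {d. d ! (j - 1) = i}"

definition expected_correct :: "nat \<Rightarrow> (nat \<Rightarrow> nat) \<Rightarrow> real" where
  "expected_correct n g =
     measure_pmf.expectation (shelf_shuffle n) (\<lambda>d. real (card {j \<in> {1..n}. d ! (j - 1) = g j}))"

definition should_guess :: "nat \<Rightarrow> nat \<Rightarrow> nat \<Rightarrow> bool" where
  "should_guess n i j \<longleftrightarrow>
     i \<in> {1..n} \<and> j \<in> {1..n} \<and> (\<forall>k\<in>{1..n}. card_prob n k j \<le> card_prob n i j)"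

definition strategy :: "nat \<Rightarrow> (nat \<Rightarrow> nat) \<Rightarrow> bool" where
  "strategy n g \<longleftrightarrow> (\<forall>j\<in>{1..n}. g j \<in> {1..n})"

definition optimal_strategy :: "nat \<Rightarrow> (nat \<Rightarrow> nat) \<Rightarrow> bool" where
  "optimal_strategy n g \<longleftrightarrow>
     strategy n g \<and> (\<forall>h. strategy n h \<longrightarrow> expected_correct n h \<le> expected_correct n g)"

lemma expected_correct_eq_sum:
  "expected_correct n g = (\<Sum>j=1..n. card_prob n (g j) j)"
proof -
  have card: "real (card {j \<in> {1..n}. d ! (j - 1) = g j}) =
      (\<Sum>j=1..n. indicat_real {d. d ! (j - 1) = g j} d)" for d :: "nat list"
    by (simp add: indicator_def sum.If_cases Int_def)
  show ?thesis
    unfolding expected_correct_def card_prob_def card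
    by (subst Bochner_Integration.integral_sum)
      (auto intro!: measure_pmf.integrable_const_bound[where B = 1] simp: indicator_def)
qed

lemma optimal_strategy_iff_should_guess:
  "optimal_strategy n g \<longleftrightarrow> (\<forall>j\<in>{1..n}. should_guess n (g j) j)"
proof
  assume opt: "optimal_strategy n g"
  show "\<forall>j\<in>{1..n}. should_guess n (g j) j"
  proof
    fix j assume j: "j \<in> {1..n}"
    have "card_prob n k j \<le> card_prob n (g j) j" if k: "k \<in> {1..n}" for k
    proof -
      have "strategy n (g(j := k))"
        using opt k by (simp add: optimal_strategy_def strategy_def)
      then have "expected_correct n (g(j := k)) \<le> expected_correct n g"
        using opt by (simp add: optimal_strategy_def)
      moreover have "expected_correct n (g(j := k)) =
          card_prob n k j + (\<Sum>i\<in>{1..n} - {j}. card_prob n (g i) i)"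
        unfolding expected_correct_eq_sum sum.remove[OF finite_atLeastAtMost j] by simp
      moreover have "expected_correct n g =
          card_prob n (g j) j + (\<Sum>i\<in>{1..n} - {j}. card_prob n (g i) i)"
        unfolding expected_correct_eq_sum sum.remove[OF finite_atLeastAtMost j] by simp
      ultimately show ?thesis
        by simp
    qed
    then show "should_guess n (g j) j"
      using opt j by (simp add: should_guess_def optimal_strategy_def strategy_def)
  qed
next
  assume "\<forall>j\<in>{1..n}. should_guess n (g j) j"
  then show "optimal_strategy n g"
    unfolding optimal_strategy_def strategy_def should_guess_def expected_correct_eq_sum
    by (auto intro!: sum_mono)
qed

end

theory Submission
  imports Defs
begin

text \<open>
  Card \<open>i\<close> is followed by \<open>i - 1\<close> cards. Placed on top, it ends up in position \<open>1 + a\<close>, where \<open>a\<close> of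
  these go to the top; placed at the bottom, in position \<open>n - b\<close>, where \<open>b\<close> of them go to the bottom.
  Hence \<open>p\<^sub>i\<^sub>,\<^sub>j = (C(i - 1, j - 1) + C(i - 1, n - j)) / 2\<^sup>i\<close>, which is invariant under
  \<open>j \<mapsto> n + 1 - j\<close>. In a middle position it has the form \<open>C(M, k) / 2\<^sup>M\<close> with \<open>k = n div 2\<close> and
  \<open>M \<le> 2 k\<close>, which increases in \<open>M\<close> and agrees for \<open>M = 2 k - 1\<close> and \<open>M = 2 k\<close>.
\<close>

section \<open>Distribution of the position of one card\<close>

lemma prob_shelf_place_Cons:
  "measure_pmf.prob (shelf_place (c # cs) pile) A =
     (measure_pmf.prob (shelf_place cs (c # pile)) A +
      measure_pmf.prob (shelf_place cs (pile @ [c])) A) / 2"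
  by (simp add: measure_pmf_bind measure_subprob field_simps
      measure_pmf.measure_bind[where N = "count_space UNIV"])

text \<open>Each later card moves \<open>c\<close> down by one if placed on top and leaves it in
  place otherwise, so its index is \<open>length xs\<close> plus a binomial variable. The induction
  step is Pascal's rule.\<close>

lemma prob_shelf_place_in_pile:
  assumes "c \<notin> set xs \<union> set ys \<union> set cs" and "j < length xs + length ys + length cs + 1"
  shows "measure_pmf.prob (shelf_place cs (xs @ c # ys)) {d. d ! j = c} =
    (if length xs \<le> j then real (length cs choose (j - length xs)) / 2 ^ length cs else 0)"
  using assms
proof (induction cs arbitrary: xs ys)
  case Nil
  then have "(xs @ c # ys) ! j = c \<longleftrightarrow> j = length xs"
    by (cases j "length xs" rule: linorder_cases)
      (auto simp: nth_append nth_Cons' dest!: nth_mem[of j xs] nth_mem[of "j - length xs - 1" ys])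
  then show ?case
    by (auto simp: binomial_eq_0)
next
  case (Cons b cs)
  have "measure_pmf.prob (shelf_place cs ((b # xs) @ c # ys)) {d. d ! j = c} =
      (if Suc (length xs) \<le> j then real (length cs choose (j - Suc (length xs))) / 2 ^ length cs else 0)"
    using Cons.IH[of "b # xs" ys] Cons.prems by simp
  moreover have "measure_pmf.prob (shelf_place cs (xs @ c # (ys @ [b]))) {d. d ! j = c} =
      (if length xs \<le> j then real (length cs choose (j - length xs)) / 2 ^ length cs else 0)"
    using Cons.IH[of xs "ys @ [b]"] Cons.prems by simp
  \<comment> \<open>The form \<open>Suc k\<close> removes truncated subtraction, so Pascal's rule
    applies by simplification.\<close>
  moreover have "j < length xs \<or> j = length xs \<or> (\<exists>k. j = length xs + Suc k)"
    by (metis add_Suc_right less_imp_Suc_add linorder_neqE_nat)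
  ultimately show ?case
    unfolding prob_shelf_place_Cons by (elim disjE exE) (simp_all add: field_simps)
qed

text \<open>However the cards \<open>us\<close> are placed, they only enlarge the pile to
  \<open>length pile + length us\<close> cards. Then \<open>c\<close> enters at index 0 or at that
  index.\<close>

lemma prob_shelf_place_in_cards:
  assumes "c \<notin> set pile \<union> set us \<union> set vs" and "j < length pile + length us + length vs + 1"
  shows "measure_pmf.prob (shelf_place (us @ c # vs) pile) {d. d ! j = c} =
    (real (length vs choose j) +
     (if length pile + length us \<le> j
      then real (length vs choose (j - (length pile + length us))) else 0)) / 2 ^ Suc (length vs)"
  using assms
proof (induction us arbitrary: pile)
  case Nil
  then show ?case
    using prob_shelf_place_in_pile[of c "[]" pile vs j] prob_shelf_place_in_pile[of c pile "[]" vs j]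
    by (simp add: prob_shelf_place_Cons add_divide_distrib del: shelf_place.simps)
next
  case (Cons b us)
  then show ?case
    using Cons.IH[of "b # pile"] Cons.IH[of "pile @ [b]"]
    by (simp add: prob_shelf_place_Cons field_simps del: shelf_place.simps)
qed

lemma card_prob_eq:
  assumes "i \<in> {1..n}" "j \<in> {1..n}"
  shows "card_prob n i j = real ((i - 1 choose (j - 1)) + (i - 1 choose (n - j))) / 2 ^ i"
proof -
  have "[1..<Suc n] = [1..<i] @ i # [Suc i..<Suc n]"
    using assms(1) upt_add_eq_append[of 1 i "Suc n - i"] by (simp add: upt_conv_Cons del: upt_Suc)
  then have split: "rev [1..<Suc n] = rev [Suc i..<Suc n] @ i # rev [1..<i]"
    by simp
  have length: "length (rev [Suc i..<Suc n]) = n - i" "length (rev [1..<i]) = i - 1"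
    by (simp_all del: upt_Suc)
  have "card_prob n i j = (real (i - 1 choose (j - 1)) +
     (if n - i \<le> j - 1 then real (i - 1 choose (j - 1 - (n - i))) else 0)) / 2 ^ i"
    unfolding card_prob_def shelf_shuffle_def split
    using assms length by (subst prob_shelf_place_in_cards) (auto simp del: upt_Suc)
  \<comment> \<open>Of the \<open>i - 1\<close> later cards, \<open>j - 1 - (n - i)\<close> go to
    the top and the complementary \<open>n - j\<close> to the bottom. If the condition fails, the
    right-hand binomial vanishes.\<close>
  also have "(if n - i \<le> j - 1 then real (i - 1 choose (j - 1 - (n - i))) else 0) =
      real (i - 1 choose (n - j))"
  proof (cases "n - i \<le> j - 1")
    case True
    then have "n - j \<le> i - 1" and eq: "j - 1 - (n - i) = i - 1 - (n - j)"
      using assms by auto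
    then show ?thesis
      unfolding eq using True binomial_symmetric[of "n - j" "i - 1"] by presburger
  next
    case False
    then have "i - 1 < n - j"
      using assms by auto
    then show ?thesis
      using False by simp
  qed
  finally show ?thesis
    by simp
qed

lemma card_prob_reflect:
  assumes "i \<in> {1..n}" "j \<in> {1..n}"
  shows "card_prob n i (n + 1 - j) = card_prob n i j"
proof -
  have "n + 1 - j \<in> {1..n}" "n + 1 - j - 1 = n - j" "n - (n + 1 - j) = j - 1"
    using assms(2) by auto
  then show ?thesis
    using assms by (simp only: card_prob_eq add.commute)
qed

lemma should_guess_reflect:
  assumes "should_guess n i j"
  shows "should_guess n i (n + 1 - j)"
  using assms unfolding should_guess_def by (auto simp: card_prob_reflect[simplified])

section \<open>Growth of the ratios \<open>C(M, k) / 2^M\<close>\<close>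

text \<open>The ratio of consecutive nonzero terms is \<open>(M + 1) / (2 (M + 1 - k))\<close>.\<close>

lemma central_binomial_ratio_mono:
  assumes "M \<le> N" "N \<le> 2 * k"
  shows "real (M choose k) / 2 ^ M \<le> real (N choose k) / 2 ^ N"
  using assms
proof (induction rule: dec_induct)
  case base
  show ?case by simp
next
  case (step N)
  have "2 * (N choose k) \<le> (Suc N choose k)"
  proof (cases "k \<le> N")
    case True
    have "(Suc N - k) * (Suc N choose k) = Suc N * (N choose k)"
      using binomial_absorb_comp[of "Suc N" k] by simp
    \<comment> \<open>The bound \<open>Suc N \<le> 2 * k\<close> gives
      \<open>2 * (Suc N - k) \<le> Suc N\<close>.\<close>
    moreover have "Suc N * (N choose k) \<ge> (2 * (Suc N - k)) * (N choose k)"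
      using step by (intro mult_right_mono) auto
    ultimately have "(Suc N - k) * (2 * (N choose k)) \<le> (Suc N - k) * (Suc N choose k)"
      by (simp add: mult.assoc mult.left_commute)
    then show ?thesis
      using True by simp
  qed (simp add: binomial_eq_0)
  then have "2 * real (N choose k) \<le> real (Suc N choose k)"
    by linarith
  then have "real (N choose k) / 2 ^ N \<le> real (Suc N choose k) / 2 ^ Suc N"
    by (simp add: field_simps)
  then show ?case
    using step by simp
qed

text \<open>By Pascal's rule and symmetry, \<open>C(2k, k)\<close> is a sum of two equal terms,
  which cancels the extra factor 2.\<close>

lemma central_binomial_ratio_eq:
  assumes "k \<ge> 1"
  shows "real (2 * k - 1 choose k) / 2 ^ (2 * k - 1) = real (2 * k choose k) / 2 ^ (2 * k)"
proof -
  obtain l where k: "k = Suc l"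
    using assms by (cases k) auto
  have "(Suc (2 * l) choose Suc l) = (Suc (2 * l) choose l)"
    using binomial_symmetric[of "Suc l" "Suc (2 * l)"] by simp
  then show ?thesis
    by (simp add: k)
qed

section \<open>Positions at and next to the ends\<close>

lemma should_guess_first:
  assumes "n \<ge> 1"
  shows "should_guess n 1 1"
proof -
  have "card_prob n k 1 \<le> card_prob n 1 1" if k: "k \<in> {1..n}" for k
  proof (cases "k = 1")
    case False
    then have "real (k - 1 choose (n - 1)) \<le> 1"
      using k by (cases "k = n") (auto simp: binomial_eq_0)
    moreover have "(2::real) ^ 2 \<le> 2 ^ k"
      using False k by (intro power_increasing) auto
    moreover have "n > 1"
      using False k by simp
    ultimately show ?thesis
      using k by (simp add: card_prob_eq field_simps binomial_eq_0)
  qed simp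
  then show ?thesis
    using assms by (auto simp: should_guess_def)
qed

text \<open>For \<open>n = 4\<close>, card 2 is absent: in position 2 it has probability 1/4, card 3
  has 3/8.\<close>

lemma should_guess_second_small:
  "should_guess 2 2 1" "should_guess 2 2 2" "should_guess 3 2 2" "should_guess 3 3 2"
  "should_guess 4 3 2"
proof -
  have "{1..2} = {1, 2::nat}" "{1..3} = {1, 2, 3::nat}" "{1..4} = {1, 2, 3, 4::nat}"
    by auto
  then show "should_guess 2 2 1" "should_guess 2 2 2" "should_guess 3 2 2" "should_guess 3 3 2"
    "should_guess 4 3 2"
    by (simp_all add: should_guess_def card_prob_eq binomial_eq_0 numeral_eq_Suc)
qed

lemma double_le_two_power: "2 * m \<le> (2::nat) ^ m"
proof (cases "m = 0")
  case False
  then have "m \<ge> 1"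
    by simp
  then show ?thesis
    by (induction rule: dec_induct) auto
qed simp

text \<open>The inequality fails at \<open>m = 2\<close>, which corresponds to the exceptional deck
  size 4.\<close>

lemma double_Suc_le_two_power:
  assumes "m \<ge> 3"
  shows "2 * (m + 1) \<le> (2::nat) ^ m"
  using assms by (induction rule: dec_induct) auto

text \<open>The bound 1/4 is the value at cards 2 and 3. The term \<open>C(k - 1, n - 2)\<close> is
  nonzero only for the last two cards, where exponential growth absorbs it.\<close>

lemma card_prob_second_le:
  assumes "n \<ge> 5" "k \<in> {1..n}"
  shows "card_prob n k 2 \<le> 1 / 4"
proof -
  define m where "m = k - 1"
  have k: "k = Suc m"
    using assms by (simp add: m_def)
  consider "m < n - 2" | "m = n - 2" | "m = n - 1"
    using assms k by fastforce
  then have "2 * (m + (m choose (n - 2))) \<le> (2::nat) ^ m"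
  proof cases
    case 1
    then show ?thesis
      using double_le_two_power[of m] by (simp add: binomial_eq_0)
  next
    case 2
    then show ?thesis
      using double_Suc_le_two_power[of m] assms by simp
  next
    case 3
    then obtain l where l: "m = Suc l" "n - 2 = l" "l \<ge> 3"
      using assms by (intro that[of "n - 2"]) auto
    then show ?thesis
      using double_Suc_le_two_power[of l] by simp
  qed
  then have "2 * real (m + (m choose (n - 2))) \<le> 2 ^ m"
    by (metis of_nat_le_iff of_nat_mult of_nat_numeral of_nat_power)
  then show ?thesis
    using assms by (simp add: card_prob_eq k field_simps)
qed

lemma should_guess_second:
  assumes "n \<ge> 5" "i \<in> {2, 3}"
  shows "should_guess n i 2"
proof -
  have "card_prob n i 2 = 1 / 4"
    using assms by (auto simp: card_prob_eq binomial_eq_0)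
  then have "\<forall>k\<in>{1..n}. card_prob n k 2 \<le> card_prob n i 2"
    using card_prob_second_le[OF assms(1)] by metis
  then show ?thesis
    using assms unfolding should_guess_def by auto
qed

section \<open>Middle positions\<close>

lemma should_guess_middle_even:
  assumes "k \<ge> 1" "i \<in> {2 * k - 1, 2 * k}"
  shows "should_guess (2 * k) i k"
proof -
  \<comment> \<open>The lower indices are \<open>k - 1\<close> and \<open>k\<close>, so Pascal's
    rule merges the two binomials.\<close>
  have prob: "card_prob (2 * k) l k = real (l choose k) / 2 ^ l" if "l \<in> {1..2 * k}" for l
    using that assms(1) choose_reduce_nat[of l k] by (auto simp: card_prob_eq)
  have "card_prob (2 * k) i k = real (2 * k choose k) / 2 ^ (2 * k)"
    using assms central_binomial_ratio_eq[of k] prob[of i] by auto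
  then show ?thesis
    using assms central_binomial_ratio_mono[of _ "2 * k" k] prob
    unfolding should_guess_def by auto
qed

lemma should_guess_middle_odd:
  assumes "i \<in> {2 * k, 2 * k + 1}" "i \<ge> 1"
  shows "should_guess (2 * k + 1) i (k + 1)"
proof -
  \<comment> \<open>Both lower indices equal \<open>k\<close>, so the sum doubles and cancels one
    factor 2.\<close>
  have prob: "card_prob (2 * k + 1) l (k + 1) = real (l - 1 choose k) / 2 ^ (l - 1)"
    if "l \<in> {1..2 * k + 1}" for l
    using that by (cases l) (auto simp: card_prob_eq)
  have "card_prob (2 * k + 1) i (k + 1) = real (2 * k choose k) / 2 ^ (2 * k)"
    using assms central_binomial_ratio_eq[of k] prob[of i] by auto
  moreover have "card_prob (2 * k + 1) l (k + 1) \<le> real (2 * k choose k) / 2 ^ (2 * k)"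
    if "l \<in> {1..2 * k + 1}" for l
    using that prob[OF that] central_binomial_ratio_mono[of "l - 1" "2 * k" k] by auto
  ultimately show ?thesis
    using assms unfolding should_guess_def by auto
qed

theorem theorem1p2:
  fixes n :: nat
  assumes "n \<ge> 1"
  shows "(\<forall>j\<in>{1, n}. should_guess n 1 j) \<and>
    (\<forall>j\<in>{2, n - 1} \<inter> {1..n}. \<exists>i\<in>{2, 3}. should_guess n i j) \<and>
    (n \<noteq> 4 \<longrightarrow> (\<forall>j\<in>{2, n - 1} \<inter> {1..n}. \<forall>i\<in>{2, 3} \<inter> {1..n}. should_guess n i j)) \<and>
    (even n \<longrightarrow> (\<forall>j\<in>{n div 2, n div 2 + 1}. \<forall>i\<in>{n - 1, n}. should_guess n i j)) \<and>
    (odd n \<longrightarrow> (\<forall>i\<in>{n - 1, n} \<inter> {1..n}. should_guess n i ((n + 1) div 2)))"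
proof (intro conjI impI)
  show "\<forall>j\<in>{1, n}. should_guess n 1 j"
    using should_guess_first[OF assms] should_guess_reflect[of n 1 1] by auto
  consider "n = 1" | "n = 2" | "n = 3" | "n = 4" | "n \<ge> 5"
    using assms by linarith
  then have second: "(\<forall>j\<in>{2, n - 1} \<inter> {1..n}. \<exists>i\<in>{2, 3}. should_guess n i j) \<and>
    (n \<noteq> 4 \<longrightarrow> (\<forall>j\<in>{2, n - 1} \<inter> {1..n}. \<forall>i\<in>{2, 3} \<inter> {1..n}. should_guess n i j))"
  proof cases
    case 4
    then show ?thesis
      using should_guess_second_small(5) should_guess_reflect[of 4 3 2] by auto
  next
    case 5
    then show ?thesis
      using should_guess_second[of n] should_guess_reflect[of n _ 2] by auto
  \<comment> \<open>For \<open>n = 1\<close> there is no such position; \<open>n = 2\<close> and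
    \<open>n = 3\<close> are the tabulated cases.\<close>
  qed (use should_guess_second_small in auto)
  then show "\<forall>j\<in>{2, n - 1} \<inter> {1..n}. \<exists>i\<in>{2, 3}. should_guess n i j"
    by blast
  show "\<forall>j\<in>{2, n - 1} \<inter> {1..n}. \<forall>i\<in>{2, 3} \<inter> {1..n}. should_guess n i j" if "n \<noteq> 4"
    using second that by blast
  show "\<forall>j\<in>{n div 2, n div 2 + 1}. \<forall>i\<in>{n - 1, n}. should_guess n i j" if n: "even n"
  proof -
    obtain k where k: "n = 2 * k"
      using n by blast
    then have "should_guess n i k" "should_guess n i (k + 1)" if "i \<in> {n - 1, n}" for i
      using that assms should_guess_middle_even[of k i] should_guess_reflect[of n i k] by auto
    then show ?thesis
      by (simp add: k)
  qed
  show "\<forall>i\<in>{n - 1, n} \<inter> {1..n}. should_guess n i ((n + 1) div 2)" if "odd n"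
    using that should_guess_middle_odd by (auto elim!: oddE)
qed

end
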